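(* Let $(U(t,s))_{t\ge s}$ be an evolution family of bounded linear operators on a real separable Hilbert space $\mathbb{H}$ and let $(\mu_{t,s})_{t\ge s}$ be a family of Borel probability measures on $\mathbb{H}$. For bounded Borel measurable $f:\mathbb{H}\to\mathbb{R}$ and $t\ge s$ set $p_{s,t}f(x)=\int_{\mathbb{H}} f(U(t,s)x+y)\,\mu_{t,s}(dy)$, $x\in\mathbb{H}$. Then $$p_{s,r}\,p_{r,t}=p_{s,t}\quad\text{on the space } B_b(\mathbb{H}) \text{ of bounded Borel functions, for all } s\le r\le t,$$ if and only if $$\mu_{t,s}=\mu_{t,r}*\bigl(\mu_{r,s}\circ U(t,r)^{-1}\bigr)\quad\text{for all } s\le r\le t.$$
   Context: An evolution family on $\mathbb{H}$ is a family $(U(t,s))_{t\ge s}$, $s,t\in\mathbb{R}$, of bounded linear operators with $U(s,s)=I$, $U(t,r)U(r,s)=U(t,s)$ for $t\ge r\ge s$, and $(t,s)\mapsto U(t,s)x$ continuous on $\{t\ge s\}$ for each $x\in\mathbb{H}$. $\mu\circ T^{-1}$ is the image of the measure $\mu$ under $T$; $*$ is convolution of measures. *)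

theory Defs
  imports "HOL-Probability.Probability"
begin

(* Real separable Hilbert spaces are the types of sort {real_inner, polish_space}:
   polish_space adds completeness and second countability, which for metric spaces
   is separability. *)

(* Only the values U t s with s \<le> t matter; the function is arbitrary elsewhere. *)
definition evolution_family :: "(real \<Rightarrow> real \<Rightarrow> ('a::real_normed_vector \<Rightarrow>\<^sub>L 'a)) \<Rightarrow> bool" where
  "evolution_family U \<longleftrightarrow>
     (\<forall>s. U s s = id_blinfun) \<and>
     (\<forall>s r t. s \<le> r \<longrightarrow> r \<le> t \<longrightarrow> U t r o\<^sub>L U r s = U t s) \<and>
     (\<forall>x. continuous_on {(t, s). s \<le> t} (\<lambda>(t, s). blinfun_apply (U t s) x))"

definition bounded_borel_functions :: "('a::topological_space \<Rightarrow> real) set" where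
  "bounded_borel_functions = {f. f \<in> borel_measurable borel \<and> bounded (range f)}"

(* HOL-Probability.Convolution restricts convolution to ordered_euclidean_space;
   this is the same formula without the restriction. *)
definition measure_convolution ::
    "'a::{topological_space, plus} measure \<Rightarrow> 'a measure \<Rightarrow> 'a measure" where
  "measure_convolution M N = distr (M \<Otimes>\<^sub>M N) borel (\<lambda>(x, y). x + y)"

(* p_{s,t} f (x). Note the index order: time runs from s to t, whereas U t s and \<mu> t s
   carry the later time first. *)
definition transition_op ::
    "(real \<Rightarrow> real \<Rightarrow> ('a::real_normed_vector \<Rightarrow>\<^sub>L 'a)) \<Rightarrow> (real \<Rightarrow> real \<Rightarrow> 'a measure) \<Rightarrow>
     real \<Rightarrow> real \<Rightarrow> ('a \<Rightarrow> real) \<Rightarrow> ('a \<Rightarrow> real)" where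
  "transition_op U \<mu> s t f = (\<lambda>x. \<integral>y. f (blinfun_apply (U t s) x + y) \<partial>\<mu> t s)"

end

theory Submission
  imports Defs
begin

text \<open>
  Both sides of the semigroup identity integrate the same translate of \<open>f\<close>. Since
  \<open>U t r\<close> is linear and \<open>U t r (U r s x) = U t s x\<close>, the inner shift \<open>U t r (U r s x + z)\<close> equals
  \<open>U t s x + U t r z\<close>, and Fubini's theorem turns \<open>p\<^bsub>s,r\<^esub> (p\<^bsub>r,t\<^esub> f) x\<close> into the integral of
  \<open>w \<mapsto> f (U t s x + w)\<close> with respect to \<open>\<nu> = \<mu> t r * (\<mu> r s \<circ> (U t r)\<^sup>-\<^sup>1)\<close>
  (lemma \<open>transition_op_comp\<close>). By definition \<open>p\<^bsub>s,t\<^esub> f x\<close> is the integral of the same function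
  with respect to \<open>\<mu> t s\<close>.

  So the semigroup property says exactly that \<open>\<nu>\<close> and \<open>\<mu> t s\<close> have the same integrals of all
  translates \<open>f (U t s x + _)\<close>. It clearly follows from \<open>\<nu> = \<mu> t s\<close>; conversely the point
  \<open>x = 0\<close> already yields the integrals of all bounded Borel functions, and these,
  through indicator functions, determine a probability measure (lemma \<open>prob_measure_eqI_bounded_borel\<close>).
\<close>

lemma prob_space_measure_convolution:
  fixes M N :: "'a::{second_countable_topology, real_normed_vector} measure"
  assumes "prob_space M" "prob_space N"
    and [measurable_cong]: "sets M = sets borel" "sets N = sets borel"
  shows "prob_space (measure_convolution M N)"
proof -
  interpret M: prob_space M by fact
  interpret N: prob_space N by fact
  interpret pair_prob_space M N ..
  show ?thesis
    unfolding measure_convolution_def by (rule prob_space_distr) measurable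
qed

text \<open>
  The order of integration is the one in which the composition of two transition operators
  produces the integrals: the innermost one belongs to the later time interval, which supplies
  the first factor of the convolution.
\<close>

lemma integral_measure_convolution:
  fixes M N :: "'a::{second_countable_topology, real_normed_vector} measure"
    and f :: "'a \<Rightarrow> real"
  assumes "prob_space M" "prob_space N"
    and [measurable_cong]: "sets M = sets borel" "sets N = sets borel"
    and f: "f \<in> bounded_borel_functions"
  shows "(\<integral>w. f w \<partial>measure_convolution M N) = (\<integral>z. \<integral>y. f (y + z) \<partial>M \<partial>N)"
proof -
  interpret M: prob_space M by fact
  interpret N: prob_space N by fact
  interpret pair_prob_space M N ..
  have [measurable]: "f \<in> borel_measurable borel"
    using f by (simp add: bounded_borel_functions_def)
  obtain B where B: "\<And>x. norm (f x) \<le> B"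
    using f by (auto simp: bounded_borel_functions_def bounded_iff)
  have "integrable (M \<Otimes>\<^sub>M N) (\<lambda>(y, z). f (y + z))"
    by (rule P.integrable_const_bound[where B = B]) (use B in auto)
  then have "(\<integral>z. \<integral>y. f (y + z) \<partial>M \<partial>N) = (\<integral>(y, z). f (y + z) \<partial>(M \<Otimes>\<^sub>M N))"
    by (rule integral_snd)
  also have "\<dots> = (\<integral>w. f w \<partial>measure_convolution M N)"
    unfolding measure_convolution_def by (subst integral_distr) (auto simp: case_prod_unfold)
  finally show ?thesis ..
qed

lemma bounded_borel_functions_translate:
  fixes f :: "'a::{second_countable_topology, real_normed_vector} \<Rightarrow> real"
  assumes "f \<in> bounded_borel_functions"
  shows "(\<lambda>w. f (a + w)) \<in> bounded_borel_functions"
proof -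
  have [measurable]: "f \<in> borel_measurable borel"
    using assms by (simp add: bounded_borel_functions_def)
  have "bounded (range (\<lambda>w. f (a + w)))"
    using assms by (auto simp: bounded_borel_functions_def intro: bounded_subset)
  then show ?thesis
    by (simp add: bounded_borel_functions_def)
qed

lemma prob_measure_eqI_bounded_borel:
  fixes M N :: "'a::topological_space measure"
  assumes "prob_space M" "prob_space N"
    and sets: "sets M = sets borel" "sets N = sets borel"
    and eq: "\<And>f. f \<in> bounded_borel_functions \<Longrightarrow> (\<integral>w. f w \<partial>M) = (\<integral>w. f w \<partial>N)"
  shows "M = N"
proof (rule measure_eqI)
  show "sets M = sets N"
    by (simp add: sets)
next
  interpret M: prob_space M by fact
  interpret N: prob_space N by fact
  fix A assume A: "A \<in> sets M"
  have "range (indicator A :: 'a \<Rightarrow> real) \<subseteq> {0, 1}"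
    by (auto simp: indicator_def)
  then have "bounded (range (indicator A :: 'a \<Rightarrow> real))"
    by (rule bounded_subset[rotated]) simp
  then have "(indicator A :: 'a \<Rightarrow> real) \<in> bounded_borel_functions"
    using A by (simp add: bounded_borel_functions_def sets)
  then have "(\<integral>w. indicator A w \<partial>M) = (\<integral>w. indicator A w \<partial>N :: real)"
    by (rule eq)
  then have "measure M A = measure N A"
    using A by (simp add: sets)
  then show "emeasure M A = emeasure N A"
    by (simp add: M.emeasure_eq_measure N.emeasure_eq_measure)
qed

text \<open>
  Additivity of \<open>U t r\<close> separates the start point \<open>x\<close> from the two noise terms: \<open>U t r\<close> transports
  both \<open>U r s x\<close> and the noise \<open>z\<close> collected up to time \<open>r\<close>. What remains is the law of the sum
  of the independent noises \<open>y\<close> and \<open>U t r z\<close>, which is a convolution.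
\<close>

lemma transition_op_comp:
  fixes U :: "real \<Rightarrow> real \<Rightarrow> ('a::{second_countable_topology, real_normed_vector} \<Rightarrow>\<^sub>L 'a)"
    and f :: "'a \<Rightarrow> real"
  assumes U: "U t r o\<^sub>L U r s = U t s"
    and prob: "prob_space (\<mu> t r)" "prob_space (\<mu> r s)"
    and sets [measurable_cong]: "sets (\<mu> t r) = sets borel" "sets (\<mu> r s) = sets borel"
    and f: "f \<in> bounded_borel_functions"
  shows "transition_op U \<mu> s r (transition_op U \<mu> r t f) x =
    (\<integral>w. f (U t s x + w) \<partial>measure_convolution (\<mu> t r) (distr (\<mu> r s) borel (U t r)))"
proof -
  interpret R: prob_space "\<mu> t r" by (rule prob)
  interpret S: prob_space "\<mu> r s" by (rule prob)
  have [measurable]: "f \<in> borel_measurable borel"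
    using f by (simp add: bounded_borel_functions_def)
  have [measurable]: "blinfun_apply (U t r) \<in> borel_measurable borel"
    by (intro borel_measurable_continuous_onI continuous_intros)
  have shift: "U t r (U r s x + z) + y = U t s x + (y + U t r z)" for y z
    by (simp add: U[symmetric] blinfun.add_right ac_simps)
  have "transition_op U \<mu> s r (transition_op U \<mu> r t f) x =
      (\<integral>z. \<integral>y. f (U t s x + (y + U t r z)) \<partial>\<mu> t r \<partial>\<mu> r s)"
    by (simp add: transition_op_def shift)
  also have "\<dots> = (\<integral>z. \<integral>y. f (U t s x + (y + z)) \<partial>\<mu> t r \<partial>distr (\<mu> r s) borel (U t r))"
    by (subst integral_distr) auto
  also have "\<dots> = (\<integral>w. f (U t s x + w)
      \<partial>measure_convolution (\<mu> t r) (distr (\<mu> r s) borel (U t r)))"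
    by (rule integral_measure_convolution[symmetric])
      (auto simp: sets prob intro!: S.prob_space_distr bounded_borel_functions_translate f)
  finally show ?thesis .
qed

theorem proposition2p1:
  fixes U :: "real \<Rightarrow> real \<Rightarrow> ('a::{real_inner, polish_space} \<Rightarrow>\<^sub>L 'a)"
    and \<mu> :: "real \<Rightarrow> real \<Rightarrow> 'a measure"
  assumes "evolution_family U"
    and "\<And>s t. s \<le> t \<Longrightarrow> prob_space (\<mu> t s)"
    and "\<And>s t. s \<le> t \<Longrightarrow> sets (\<mu> t s) = sets borel"
  shows "(\<forall>s r t. s \<le> r \<longrightarrow> r \<le> t \<longrightarrow>
            (\<forall>f \<in> bounded_borel_functions.
               transition_op U \<mu> s r (transition_op U \<mu> r t f) = transition_op U \<mu> s t f))
     \<longleftrightarrow> (\<forall>s r t. s \<le> r \<longrightarrow> r \<le> t \<longrightarrow>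
            \<mu> t s = measure_convolution (\<mu> t r) (distr (\<mu> r s) borel (blinfun_apply (U t r))))"
proof -
  have "(\<forall>f \<in> bounded_borel_functions.
           transition_op U \<mu> s r (transition_op U \<mu> r t f) = transition_op U \<mu> s t f)
     \<longleftrightarrow> \<mu> t s = measure_convolution (\<mu> t r) (distr (\<mu> r s) borel (U t r))"
    (is "?semigroup \<longleftrightarrow> \<mu> t s = ?\<nu>")
    if le: "s \<le> r" "r \<le> t" for s r t
  proof -
    have comp: "transition_op U \<mu> s r (transition_op U \<mu> r t f) x = (\<integral>w. f (U t s x + w) \<partial>?\<nu>)"
      if "f \<in> bounded_borel_functions" for f x
      using assms le that by (intro transition_op_comp) (auto simp: evolution_family_def)
    have "blinfun_apply (U t r) \<in> borel_measurable borel"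
      by (intro borel_measurable_continuous_onI continuous_intros)
    then have "blinfun_apply (U t r) \<in> \<mu> r s \<rightarrow>\<^sub>M borel"
      using assms(3)[OF le(1)] by (simp cong: measurable_cong_sets)
    then have \<nu>: "prob_space ?\<nu>"
      using assms le by (intro prob_space_measure_convolution prob_space.prob_space_distr) auto
    show ?thesis
    proof
      assume semigroup: ?semigroup
      show "\<mu> t s = ?\<nu>"
      proof (rule prob_measure_eqI_bounded_borel)
        fix f :: "'a \<Rightarrow> real" assume f: "f \<in> bounded_borel_functions"
        have "transition_op U \<mu> s t f 0 = (\<integral>w. f (U t s 0 + w) \<partial>?\<nu>)"
          using semigroup f comp[OF f, of 0] by simp
        then show "(\<integral>w. f w \<partial>\<mu> t s) = (\<integral>w. f w \<partial>?\<nu>)"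
          by (simp add: transition_op_def blinfun.zero_right)
      qed (use assms le \<nu> in \<open>auto simp: measure_convolution_def\<close>)
    next
      assume "\<mu> t s = ?\<nu>"
      then show ?semigroup
        by (auto simp: comp transition_op_def[of U \<mu> s t])
    qed
  qed
  then show ?thesis by blast
qed

end
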